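(* A ring $R$ is strongly periodic if and only if $R$ is a 2-primal weakly periodic ring.
   Context: All rings are associative with identity. $P(R)$ is the prime radical of $R$ (the intersection of all prime ideals), and $N(R)$ is the set of all nilpotent elements of $R$. An element $p\in R$ is potent if $p=p^m$ for some integer $m\ge 2$. A ring $R$ is strongly periodic if for every $a\in R$ there exists a potent $p\in R$ such that $a-p\in P(R)$ and $ap=pa$. A ring $R$ is 2-primal if $N(R)=P(R)$. A ring $R$ is weakly periodic if for every $a\in R$ there exists a potent $p\in R$ such that $a-p\in N(R)$. *)

theory Defs
  imports "HOL-Algebra.Ideal_Product"
begin

text \<open>The library locale primeideal is tied to commutative rings.  The notion below is the
  standard one for associative rings with identity: a proper two-sided ideal P such that
  \<open>I J \<subseteq> P\<close> implies \<open>I \<subseteq> P\<close> or \<open>J \<subseteq> P\<close> for all two-sided ideals I and J.\<close>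

definition nc_prime_ideal :: "'a set \<Rightarrow> ('a, 'b) ring_scheme \<Rightarrow> bool" where
  "nc_prime_ideal P R \<longleftrightarrow>
     ideal P R \<and> P \<noteq> carrier R \<and>
     (\<forall>I J. ideal I R \<longrightarrow> ideal J R \<longrightarrow> ideal_prod R I J \<subseteq> P \<longrightarrow> I \<subseteq> P \<or> J \<subseteq> P)"

text \<open>Intersecting with the carrier only matters for the zero ring: it has no prime ideals, and
  the empty intersection is the whole ring.\<close>

definition prime_radical :: "('a, 'b) ring_scheme \<Rightarrow> 'a set" where
  "prime_radical R = carrier R \<inter> \<Inter>{P. nc_prime_ideal P R}"

definition nilpotent_elements :: "('a, 'b) ring_scheme \<Rightarrow> 'a set" where
  "nilpotent_elements R =
     {x \<in> carrier R. \<exists>n::nat. n \<ge> 1 \<and> x [^]\<^bsub>R\<^esub> n = \<zero>\<^bsub>R\<^esub>}"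

definition potent :: "('a, 'b) ring_scheme \<Rightarrow> 'a \<Rightarrow> bool" where
  "potent R p \<longleftrightarrow> p \<in> carrier R \<and> (\<exists>m::nat. m \<ge> 2 \<and> p = p [^]\<^bsub>R\<^esub> m)"

definition strongly_periodic :: "('a, 'b) ring_scheme \<Rightarrow> bool" where
  "strongly_periodic R \<longleftrightarrow>
     (\<forall>a \<in> carrier R. \<exists>p. potent R p \<and> a \<ominus>\<^bsub>R\<^esub> p \<in> prime_radical R \<and>
        a \<otimes>\<^bsub>R\<^esub> p = p \<otimes>\<^bsub>R\<^esub> a)"

definition two_primal :: "('a, 'b) ring_scheme \<Rightarrow> bool" where
  "two_primal R \<longleftrightarrow> nilpotent_elements R = prime_radical R"

definition weakly_periodic :: "('a, 'b) ring_scheme \<Rightarrow> bool" where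
  "weakly_periodic R \<longleftrightarrow>
     (\<forall>a \<in> carrier R. \<exists>p. potent R p \<and> a \<ominus>\<^bsub>R\<^esub> p \<in> nilpotent_elements R)"

end

theory Submission
  imports Defs "HOL-Algebra.Ring_Divisibility" "HOL-Algebra.Subrings"
begin

text \<open>The prime radical \<open>P\<close> is a nil ideal, by Zorn's lemma. If \<open>R\<close> is strongly periodic and \<open>a\<close> is
  nilpotent with \<open>a - p \<in> P\<close>, then some power of the potent element \<open>p\<close> lies in \<open>P\<close>, hence
  \<open>p \<in> P\<close> and \<open>a \<in> P\<close>.

  Conversely, let the nilpotent elements form the ideal \<open>P\<close>. Comparing \<open>2\<close> with a potent element
  makes \<open>2 ^ m - 2\<close> nilpotent, so \<open>R\<close> has positive characteristic \<open>n\<close>. For every \<open>a\<close> some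
  \<open>u = a ^ m - a\<close> lies in \<open>P\<close>, and raising \<open>a ^ m = a + u\<close> to the \<open>n\<close>-th power repeatedly increases
  the power of \<open>u\<close> in the error term, so \<open>a ^ (m * n ^ k) = a ^ (n ^ k)\<close> for large \<open>k\<close>. Hence high
  powers of \<open>a\<close> are potent; among them are powers congruent to \<open>a\<close> modulo \<open>P\<close>, and these commute
  with \<open>a\<close>.\<close>

section \<open>The prime radical is a nil ideal\<close>

lemma (in ring) prime_radical_ideal: "ideal (prime_radical R) R"
proof -
  \<comment> \<open>Inserting the carrier keeps the family nonempty even when there are no prime
    ideals.\<close>
  have "ideal (\<Inter> (insert (carrier R) {P. nc_prime_ideal P R})) R"
    by (rule i_Intersect) (auto simp: nc_prime_ideal_def oneideal)
  then show ?thesis by (simp add: prime_radical_def)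
qed

text \<open>If neither \<open>I\<close> nor \<open>J\<close> lies in \<open>M\<close>, maximality
  puts a power of \<open>a\<close> into each of \<open>M <+> I\<close> and \<open>M <+> J\<close>.
  The product of these two powers falls into \<open>M\<close> as soon as \<open>IJ\<close> does, a
  contradiction.\<close>

lemma (in ring) maximal_power_avoiding_ideal_prime:
  assumes a: "a \<in> carrier R"
    and M: "ideal M R" "\<And>n::nat. a [^] n \<notin> M"
    and max: "\<And>J. ideal J R \<Longrightarrow> (\<And>n::nat. a [^] n \<notin> J) \<Longrightarrow> M \<subseteq> J \<Longrightarrow> J = M"
  shows "nc_prime_ideal M R"
  unfolding nc_prime_ideal_def
proof (intro conjI allI impI)
  interpret M: ideal M R by (rule M(1))
  show "ideal M R" by fact
  \<comment> \<open>Exponent 0 is included among the avoided powers, so \<open>M\<close> misses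
    \<open>\<one>\<close>.\<close>
  show "M \<noteq> carrier R" using M(2)[of 0] by auto
  have pow_split: "\<exists>n::nat. \<exists>x\<in>M. \<exists>y\<in>I. a [^] n = x \<oplus> y"
    if I: "ideal I R" and nI: "\<not> I \<subseteq> M" for I
  proof (rule ccontr)
    interpret I: ideal I R by (rule I)
    assume "\<not> ?thesis"
    then have "\<And>n::nat. a [^] n \<notin> M <+> I" by (auto simp: set_add_def')
    moreover have "M \<subseteq> M <+> I"
    proof
      fix x assume x: "x \<in> M"
      have "x \<oplus> \<zero> \<in> M <+> I" unfolding set_add_def' using x I.zero_closed by blast
      then show "x \<in> M <+> I" using M.Icarr[OF x] by simp
    qed
    ultimately have "M <+> I = M"
      using max add_ideals[OF M(1) I] by blast
    moreover have "I \<subseteq> M <+> I"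
    proof
      fix x assume x: "x \<in> I"
      have "\<zero> \<oplus> x \<in> M <+> I" unfolding set_add_def' using x M.zero_closed by blast
      then show "x \<in> M <+> I" using I.Icarr[OF x] by simp
    qed
    ultimately show False using nI by blast
  qed
  fix I J assume I: "ideal I R" and J: "ideal J R" and IJ: "ideal_prod R I J \<subseteq> M"
  interpret I: ideal I R by (rule I)
  interpret J: ideal J R by (rule J)
  show "I \<subseteq> M \<or> J \<subseteq> M"
  proof (rule ccontr)
    assume "\<not> ?thesis"
    then obtain i j :: nat and x y x' y'
      where i: "x \<in> M" "y \<in> I" "a [^] i = x \<oplus> y" and j: "x' \<in> M" "y' \<in> J" "a [^] j = x' \<oplus> y'"
      using pow_split[OF I] pow_split[OF J] by blast
    have "a [^] (i + j) = (x \<oplus> y) \<otimes> (x' \<oplus> y')"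
      using a i j by (simp flip: nat_pow_mult)
    also have "\<dots> = x \<otimes> (x' \<oplus> y') \<oplus> (y \<otimes> x' \<oplus> y \<otimes> y')"
      using i j M.Icarr I.Icarr J.Icarr by (simp add: l_distr r_distr a_ac)
    also have "\<dots> \<in> M"
    proof (intro M.a_closed)
      show "x \<otimes> (x' \<oplus> y') \<in> M" "y \<otimes> x' \<in> M"
        using i j M.Icarr I.Icarr J.Icarr by (simp_all add: M.I_l_closed M.I_r_closed)
      show "y \<otimes> y' \<in> M" using i j IJ by (blast intro: ideal_prod.prod)
    qed
    finally show False using M(2) by blast
  qed
qed

text \<open>For a non-nilpotent \<open>a\<close>, an ideal maximal among those avoiding all powers
  of \<open>a\<close> is prime and does not contain \<open>a\<close>.\<close>

lemma (in ring) prime_radical_nil: "prime_radical R \<subseteq> nilpotent_elements R"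
proof
  fix a assume aP: "a \<in> prime_radical R"
  then have a: "a \<in> carrier R" by (simp add: prime_radical_def)
  show "a \<in> nilpotent_elements R"
  proof (rule ccontr)
    assume "a \<notin> nilpotent_elements R"
    then have nz: "a [^] n \<noteq> \<zero>" if "n \<ge> 1" for n :: nat
      using a that by (auto simp: nilpotent_elements_def)
    \<comment> \<open>Exponent 0 is covered too: if \<open>\<one> = \<zero>\<close>, then already
      the first power of \<open>a\<close> vanishes.\<close>
    have nz: "a [^] n \<noteq> \<zero>" for n :: nat
    proof
      assume "a [^] n = \<zero>"
      then have "a [^] Suc n = \<zero>" using a by simp
      then show False using nz[of "Suc n"] by simp
    qed
    define A where "A = {I. ideal I R \<and> (\<forall>n::nat. a [^] n \<notin> I)}"
    have "\<exists>M\<in>A. \<forall>X\<in>A. M \<subseteq> X \<longrightarrow> X = M"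
    proof (rule subset_Zorn_nonempty)
      show "A \<noteq> {}" using zeroideal nz by (auto simp: A_def)
      fix C assume C: "C \<noteq> {}" "subset.chain A C"
      then have "subset.chain {I. ideal I R} C"
        by (auto simp: A_def pred_on.chain_def)
      then have "ideal (\<Union>C) R" using chain_Union_is_ideal[of C] C(1) by simp
      then show "\<Union>C \<in> A" using C(2) by (auto simp: A_def pred_on.chain_def)
    qed
    then obtain M where M: "M \<in> A" "\<And>X. X \<in> A \<Longrightarrow> M \<subseteq> X \<Longrightarrow> X = M" by blast
    have "nc_prime_ideal M R"
      by (rule maximal_power_avoiding_ideal_prime[OF a]) (use M in \<open>auto simp: A_def\<close>)
    then have "a [^] (1::nat) \<in> M" using aP a by (simp add: prime_radical_def)
    then show False using M(1) unfolding A_def by blast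
  qed
qed

section \<open>Congruences modulo an ideal and potent elements\<close>

lemma (in ideal) diff_sym:
  assumes "x \<in> carrier R" "y \<in> carrier R" "x \<ominus> y \<in> I"
  shows "y \<ominus> x \<in> I"
proof -
  have "y \<ominus> x = \<ominus> (x \<ominus> y)" using assms by algebra
  then show ?thesis using assms by simp
qed

lemma (in ideal) diff_trans:
  assumes "x \<in> carrier R" "y \<in> carrier R" "z \<in> carrier R" "x \<ominus> y \<in> I" "y \<ominus> z \<in> I"
  shows "x \<ominus> z \<in> I"
proof -
  have "x \<ominus> z = (x \<ominus> y) \<oplus> (y \<ominus> z)" using assms by algebra
  then show ?thesis using assms by simp
qed

lemma (in ideal) diff_pow:
  fixes n :: nat
  assumes "x \<in> carrier R" "y \<in> carrier R" "x \<ominus> y \<in> I"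
  shows "x [^] n \<ominus> y [^] n \<in> I"
proof (induction n)
  case 0
  show ?case by (simp add: a_minus_def r_neg)
next
  case (Suc n)
  \<comment> \<open>This telescoping identity does not require \<open>x\<close> and \<open>y\<close>
    to commute.\<close>
  have "x [^] Suc n \<ominus> y [^] Suc n = x [^] n \<otimes> (x \<ominus> y) \<oplus> (x [^] n \<ominus> y [^] n) \<otimes> y"
    using assms(1,2) nat_pow_closed[OF assms(1), of n] nat_pow_closed[OF assms(2), of n]
    unfolding nat_pow_Suc by algebra
  also have "\<dots> \<in> I"
    using assms Suc by (simp add: I_l_closed I_r_closed)
  finally show ?case .
qed

lemma (in ring) potent_pow:
  fixes m k :: nat
  assumes p: "p \<in> carrier R" and m: "m \<ge> 2" and pm: "p = p [^] m"
  shows "p [^] (1 + k * (m - 1)) = p"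
proof (induction k)
  case 0
  show ?case using p by simp
next
  case (Suc k)
  have e: "1 + Suc k * (m - 1) = (1 + k * (m - 1)) + (m - 1)" by simp
  have "p [^] (1 + Suc k * (m - 1)) = p \<otimes> p [^] (m - 1)"
    using p Suc nat_pow_mult[of p "1 + k * (m - 1)" "m - 1"] unfolding e by simp
  also have "\<dots> = p [^] (1 + (m - 1))" using p by (metis nat_pow_mult nat_pow_eone)
  also have "\<dots> = p" using pm m by simp
  finally show ?case .
qed

text \<open>A potent \<open>p\<close> equals powers of itself with arbitrarily large exponents, so
  it is a multiple of \<open>p [^] n\<close>.\<close>

lemma (in ideal) potent_mem_if_pow_mem:
  fixes n :: nat
  assumes "potent R p" and pn: "p [^] n \<in> I"
  shows "p \<in> I"
proof -
  obtain m :: nat where p: "p \<in> carrier R" and m: "m \<ge> 2" "p = p [^] m"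
    using assms by (auto simp: potent_def)
  have "n \<le> 1 + n * (m - 1)" using m(1) mult_le_mono2[of 1 "m - 1" n] by linarith
  then obtain l where l: "1 + n * (m - 1) = n + l" using le_Suc_ex by blast
  have "p = p [^] n \<otimes> p [^] l"
    using potent_pow[OF p m, of n] p unfolding l by (simp add: nat_pow_mult)
  also have "\<dots> \<in> I" using pn p by (simp add: I_r_closed)
  finally show ?thesis .
qed

section \<open>Powers of sums in positive characteristic\<close>

text \<open>This is the binomial expansion to first order in \<open>d\<close>. When the exponent
  annihilates the ring, the linear term drops out and an error divisible by
  \<open>d \<otimes> d\<close> remains.\<close>

lemma (in cring) pow_Suc_add_expansion:
  assumes y: "y \<in> carrier R" and d: "d \<in> carrier R"
  shows "\<exists>c\<in>carrier R. (y \<oplus> d) [^] Suc n =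
    y [^] Suc n \<oplus> add_pow R (Suc n) (y [^] n \<otimes> d) \<oplus> d \<otimes> d \<otimes> c"
proof (induction n)
  case 0
  show ?case using y d by (intro bexI[of _ \<zero>]) auto
next
  case (Suc n)
  define z where "z = add_pow R (Suc n) (y [^] n \<otimes> d)"
  \<comment> \<open>With \<open>t\<close> as coefficient of the linear term, multiplying by
    \<open>y \<oplus> d\<close> turns the remainder factor \<open>c\<close> into
    \<open>t \<oplus> c \<otimes> (y \<oplus> d)\<close>.\<close>
  define t where "t = add_pow R (Suc n) (y [^] n)"
  define v where "v = y [^] n"
  from Suc obtain c where c: "c \<in> carrier R" "(y \<oplus> d) [^] Suc n = y [^] Suc n \<oplus> z \<oplus> d \<otimes> d \<otimes> c"
    unfolding z_def by blast
  have cl: "t \<in> carrier R" "v \<in> carrier R" using y by (auto simp: t_def v_def)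
  have zt: "z = t \<otimes> d" using y d by (simp only: z_def t_def add_pow_ldistr nat_pow_closed)
  have vy: "y [^] Suc n = v \<otimes> y" by (simp add: v_def)
  have "add_pow R (Suc (Suc n)) (y [^] Suc n \<otimes> d) = add_pow R (Suc n) (y [^] n \<otimes> (y \<otimes> d)) \<oplus> v \<otimes> y \<otimes> d"
    using y d by (simp add: v_def m_assoc)
  also have "add_pow R (Suc n) (y [^] n \<otimes> (y \<otimes> d)) = t \<otimes> (y \<otimes> d)"
    using y d by (simp only: t_def add_pow_ldistr m_closed nat_pow_closed)
  finally have e: "add_pow R (Suc (Suc n)) (y [^] Suc n \<otimes> d) = t \<otimes> (y \<otimes> d) \<oplus> v \<otimes> y \<otimes> d" .
  have "(y \<oplus> d) [^] Suc (Suc n) = (v \<otimes> y \<oplus> t \<otimes> d \<oplus> d \<otimes> d \<otimes> c) \<otimes> (y \<oplus> d)"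
    using c(2) unfolding zt vy by (simp only: nat_pow_Suc)
  also have "\<dots> = v \<otimes> y \<otimes> y \<oplus> (t \<otimes> (y \<otimes> d) \<oplus> v \<otimes> y \<otimes> d) \<oplus> d \<otimes> d \<otimes> (t \<oplus> c \<otimes> (y \<oplus> d))"
    using cl y d c(1) by algebra
  also have "\<dots> = y [^] Suc (Suc n) \<oplus> add_pow R (Suc (Suc n)) (y [^] Suc n \<otimes> d)
      \<oplus> d \<otimes> d \<otimes> (t \<oplus> c \<otimes> (y \<oplus> d))"
    unfolding e by (simp only: nat_pow_Suc v_def)
  finally show ?case using cl y d c(1) by blast
qed

text \<open>If the error \<open>d\<close> is divisible by \<open>u [^] Suc k\<close>, one more
  \<open>n\<close>-th power replaces it by a multiple of \<open>d \<otimes> d\<close>, which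
  contains at least one further factor \<open>u\<close>.\<close>

lemma (in cring) pow_add_pow_char:
  fixes n k :: nat
  assumes x: "y \<in> carrier R" "u \<in> carrier R"
    and n: "n \<ge> 1" "\<And>z. z \<in> carrier R \<Longrightarrow> add_pow R n z = \<zero>"
  shows "\<exists>c\<in>carrier R. (y \<oplus> u) [^] (n ^ k) = y [^] (n ^ k) \<oplus> u [^] Suc k \<otimes> c"
proof (induction k)
  case 0
  show ?case using x by (intro bexI[of _ \<one>]) auto
next
  case (Suc k)
  then obtain c where c: "c \<in> carrier R"
    "(y \<oplus> u) [^] (n ^ k) = y [^] (n ^ k) \<oplus> u [^] Suc k \<otimes> c" by blast
  define d where "d = u [^] Suc k \<otimes> c"
  define Y where "Y = y [^] (n ^ k)"
  define v where "v = u [^] k"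
  have cl: "d \<in> carrier R" "Y \<in> carrier R" "v \<in> carrier R"
    using x c by (auto simp: d_def Y_def v_def)
  obtain j where j: "n = Suc j" using n(1) by (cases n) auto
  obtain e where e: "e \<in> carrier R"
    "(Y \<oplus> d) [^] n = Y [^] n \<oplus> add_pow R n (Y [^] j \<otimes> d) \<oplus> d \<otimes> d \<otimes> e"
    using pow_Suc_add_expansion[OF cl(2,1), of j] unfolding j by blast
  have "d \<otimes> d \<otimes> e = (v \<otimes> u \<otimes> c) \<otimes> (v \<otimes> u \<otimes> c) \<otimes> e" by (simp add: d_def v_def)
  also have "\<dots> = v \<otimes> u \<otimes> u \<otimes> (v \<otimes> c \<otimes> c \<otimes> e)"
    using cl x c(1) e(1) by algebra
  finally have dd: "d \<otimes> d \<otimes> e = u [^] Suc (Suc k) \<otimes> (v \<otimes> c \<otimes> c \<otimes> e)" by (simp add: v_def)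
  have "(y \<oplus> u) [^] (n ^ Suc k) = (Y \<oplus> d) [^] n"
    using x c(2) by (simp add: d_def Y_def mult.commute[of n] flip: nat_pow_pow)
  also have "\<dots> = Y [^] n \<oplus> u [^] Suc (Suc k) \<otimes> (v \<otimes> c \<otimes> c \<otimes> e)"
    using cl x c(1) e n(2)[of "Y [^] j \<otimes> d"] dd by simp
  also have "Y [^] n = y [^] (n ^ Suc k)"
    using x by (simp add: Y_def mult.commute[of n] nat_pow_pow)
  finally show ?case using cl c(1) e(1) by blast
qed

text \<open>The bicommutant of \<open>a\<close> is commutative because each of its elements commutes
  with \<open>a\<close> and is therefore one of the test elements \<open>y\<close>. It provides a
  commutative setting for computations with powers of \<open>a\<close>.\<close>

lemma (in ring) bicommutant_cring:
  assumes a: "a \<in> carrier R"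
  defines "C \<equiv> {x \<in> carrier R. \<forall>y\<in>carrier R. y \<otimes> a = a \<otimes> y \<longrightarrow> x \<otimes> y = y \<otimes> x}"
  shows "cring (R\<lparr>carrier := C\<rparr>)"
proof -
  have Ca: "x \<otimes> a = a \<otimes> x" if "x \<in> C" for x using that a by (auto simp: C_def)
  have "subring C R"
  proof (rule subringI)
    fix h assume h: "h \<in> C"
    then show "\<ominus> h \<in> C" by (auto simp: C_def l_minus r_minus)
    fix k assume k: "k \<in> C"
    show "h \<oplus> k \<in> C" using h k by (auto simp: C_def l_distr r_distr)
    show "h \<otimes> k \<in> C" using h k by (auto simp: C_def) (metis m_assoc)
  qed (auto simp: C_def)
  then have "subcring C R"
  proof (rule subcringI)
    fix x y assume x: "x \<in> C" and y: "y \<in> C"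
    have "y \<in> carrier R" using y by (simp add: C_def)
    then show "x \<otimes> y = y \<otimes> x" using x Ca[OF y] by (simp add: C_def)
  qed
  moreover have "C \<subseteq> carrier R" by (auto simp: C_def)
  ultimately show ?thesis using subcring_iff by blast
qed

text \<open>In the bicommutant of \<open>a\<close>, write \<open>a [^] m\<close> as
  \<open>a \<oplus> u\<close> and raise it to the power \<open>n ^ k\<close>; the error has the
  factor \<open>u [^] Suc k\<close>, which is zero.\<close>

lemma (in ring) pow_eq_if_diff_nilpotent:
  fixes n m k :: nat
  assumes a: "a \<in> carrier R"
    and n: "n \<ge> 1" "\<And>z. z \<in> carrier R \<Longrightarrow> add_pow R n z = \<zero>"
    and nil: "(a [^] m \<ominus> a) [^] k = \<zero>"
  shows "a [^] (m * n ^ k) = a [^] (n ^ k)"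
proof -
  define C where "C = {x \<in> carrier R. \<forall>y\<in>carrier R. y \<otimes> a = a \<otimes> y \<longrightarrow> x \<otimes> y = y \<otimes> x}"
  define u where "u = a [^] m \<ominus> a"
  interpret C: cring "R\<lparr>carrier := C\<rparr>" unfolding C_def by (rule bicommutant_cring[OF a])
  have aC: "a \<in> C" using a by (auto simp: C_def)
  have am: "a [^] m \<in> C"
    using C.nat_pow_closed[of a m] aC by (simp flip: nat_pow_consistent)
  have uC: "u \<in> C"
  proof -
    have "u \<otimes> y = y \<otimes> u" if y: "y \<in> carrier R" "y \<otimes> a = a \<otimes> y" for y
    proof -
      have "a [^] m \<otimes> y = y \<otimes> a [^] m" using am y by (auto simp: C_def)
      then show ?thesis
        using y a by (simp add: u_def a_minus_def l_distr r_distr l_minus r_minus)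
    qed
    then show ?thesis using a by (auto simp: C_def u_def)
  qed
  have u: "u \<in> carrier R" using a by (simp add: u_def)
  have au: "a \<oplus> u = a [^] m"
    using a nat_pow_closed[OF a, of m] unfolding u_def by algebra
  have nC: "add_pow (R\<lparr>carrier := C\<rparr>) n z = \<zero>" if "z \<in> C" for z
    using n(2)[of z] that by (simp add: add_pow_def nat_pow_def C_def)
  have uk: "u [^] Suc k = \<zero>" using nil u by (simp add: u_def)
  obtain c where c: "c \<in> C" "(a [^] m) [^] (n ^ k) = a [^] (n ^ k) \<oplus> u [^] Suc k \<otimes> c"
    using C.pow_add_pow_char[of a u n k] aC uC n(1) nC au
    by (auto simp del: nat_pow_Suc C.nat_pow_Suc simp flip: nat_pow_consistent)
  then show ?thesis using a uk by (auto simp: C_def nat_pow_pow)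
qed

text \<open>This turns nilpotency of an integer multiple of \<open>\<one>\<close> into the vanishing
  of another integer multiple.\<close>

lemma (in ring) add_pow_one_pow:
  fixes j k :: nat
  shows "(add_pow R j \<one>) [^] k = add_pow R (j ^ k) \<one>"
proof (induction k)
  case (Suc k)
  have "(add_pow R j \<one>) [^] Suc k = add_pow R (j ^ k) \<one> \<otimes> add_pow R j \<one>" using Suc by simp
  also have "\<dots> = add_pow R (j ^ Suc k) \<one>"
    by (simp add: add_pow_rdistr add.nat_pow_pow mult.commute)
  finally show ?case .
qed simp

section \<open>The two implications\<close>

lemma (in ring) strongly_periodic_imp_two_primal_weakly_periodic:
  assumes sp: "strongly_periodic R"
  shows "two_primal R" "weakly_periodic R"
proof -
  interpret P: ideal "prime_radical R" R by (rule prime_radical_ideal)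
  show "weakly_periodic R"
    using sp prime_radical_nil unfolding strongly_periodic_def weakly_periodic_def by blast
  have "a \<in> prime_radical R" if an: "a \<in> nilpotent_elements R" for a
  proof -
    obtain n :: nat where a: "a \<in> carrier R" "a [^] n = \<zero>"
      using an by (auto simp: nilpotent_elements_def)
    obtain p where p: "potent R p" "a \<ominus> p \<in> prime_radical R"
      using sp a(1) unfolding strongly_periodic_def by blast
    have pc: "p \<in> carrier R" using p by (simp add: potent_def)
    have "p [^] n \<ominus> a [^] n \<in> prime_radical R"
      using P.diff_pow P.diff_sym a pc p(2) by blast
    then have "p [^] n \<in> prime_radical R" using pc a(2) by (simp add: a_minus_def)
    then have "p \<in> prime_radical R" using P.potent_mem_if_pow_mem p(1) by blast
    then have "(a \<ominus> p) \<oplus> p \<in> prime_radical R" using p(2) by simp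
    moreover have "(a \<ominus> p) \<oplus> p = a" using a pc by algebra
    ultimately show ?thesis by simp
  qed
  then show "two_primal R" using prime_radical_nil unfolding two_primal_def by blast
qed

lemma (in ring) two_primal_weakly_periodic_imp_strongly_periodic:
  assumes "two_primal R" and wp: "weakly_periodic R"
  shows "strongly_periodic R"
proof -
  interpret P: ideal "prime_radical R" R by (rule prime_radical_ideal)
  have N: "nilpotent_elements R = prime_radical R"
    using assms by (simp add: two_primal_def)
  \<comment> \<open>The potent element near \<open>a\<close> might not commute with
    \<open>a\<close>. Since it equals its powers with these exponents, it can be replaced by the
    corresponding powers of \<open>a\<close>.\<close>
  have pot: "\<exists>m::nat. m \<ge> 2 \<and> (\<forall>k. a \<ominus> a [^] (1 + k * (m - 1)) \<in> prime_radical R)"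
    if a: "a \<in> carrier R" for a
  proof -
    obtain p and m :: nat where p: "p \<in> carrier R" "m \<ge> 2" "p = p [^] m"
      and ap: "a \<ominus> p \<in> prime_radical R"
      using wp a unfolding weakly_periodic_def N potent_def by blast
    have "a \<ominus> a [^] (1 + k * (m - 1)) \<in> prime_radical R" for k
    proof -
      have "a [^] (1 + k * (m - 1)) \<ominus> p \<in> prime_radical R"
        using P.diff_pow[OF a p(1) ap, of "1 + k * (m - 1)"] potent_pow[OF p, of k] by simp
      then show ?thesis
        using P.diff_trans[OF a p(1) nat_pow_closed[OF a] ap] P.diff_sym[OF nat_pow_closed[OF a] p(1)]
        by blast
    qed
    then show ?thesis using p(2) by blast
  qed
  obtain n :: nat where n: "n \<ge> 1" "add_pow R n \<one> = \<zero>"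
  proof -
    define t where "t = add_pow R (2::nat) \<one>"
    have t: "t \<in> carrier R" by (simp add: t_def)
    obtain m :: nat where m: "m \<ge> 2"
      and pm: "\<And>k. t \<ominus> t [^] (1 + k * (m - 1)) \<in> prime_radical R"
      using pot[OF t] by blast
    \<comment> \<open>\<open>t\<close> stands for 2, so \<open>t [^] m \<ominus> t\<close> is
      \<open>q\<close> times \<open>\<one>\<close>. Its nilpotency yields the characteristic bound
      \<open>q ^ k\<close>, which is positive because \<open>m \<ge> 2\<close>.\<close>
    define q :: nat where "q = 2 ^ m - 2"
    have "(2::nat) ^ 2 \<le> 2 ^ m" by (rule power_increasing) (use m in auto)
    then have q: "2 ^ m = q + 2" "q \<ge> 1" by (auto simp: q_def)
    have "t [^] m \<ominus> t \<in> nilpotent_elements R"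
      using P.diff_sym[OF t nat_pow_closed[OF t] pm[of 1]] m N by simp
    moreover have "t [^] m \<ominus> t = add_pow R q \<one>"
    proof -
      have "t [^] m = add_pow R q \<one> \<oplus> t"
        unfolding t_def add_pow_one_pow q(1) by (simp only: add.nat_pow_mult one_closed)
      then show ?thesis using t by (simp add: a_minus_def a_assoc r_neg)
    qed
    ultimately obtain k :: nat where "add_pow R (q ^ k) \<one> = \<zero>"
      by (auto simp: nilpotent_elements_def add_pow_one_pow)
    then show ?thesis using that[of "q ^ k"] q(2) by simp
  qed
  have char: "add_pow R n z = \<zero>" if "z \<in> carrier R" for z
    using that n(2) add_pow_ldistr[of \<one> z n] by simp
  show "strongly_periodic R"
    unfolding strongly_periodic_def
  proof
    fix a assume a: "a \<in> carrier R"
    obtain m :: nat where m: "m \<ge> 2"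
      and pm: "\<And>k. a \<ominus> a [^] (1 + k * (m - 1)) \<in> prime_radical R"
      using pot[OF a] by blast
    have "a [^] m \<ominus> a \<in> nilpotent_elements R"
      using P.diff_sym pm[of 1] a m N by simp
    then obtain k :: nat where "(a [^] m \<ominus> a) [^] k = \<zero>"
      by (auto simp: nilpotent_elements_def)
    then have per: "a [^] (m * n ^ k) = a [^] (n ^ k)"
      using pow_eq_if_diff_nilpotent[OF a n(1)] char by blast
    \<comment> \<open>From exponent \<open>i\<close> on, the powers of \<open>a\<close> have period
      \<open>d\<close>, as \<open>i + d = m * i\<close>. The exponent \<open>s = 1 + d\<close> is at
      least \<open>i\<close> and is 1 modulo \<open>m - 1\<close>, so \<open>a [^] s\<close> is both
      periodic and congruent to \<open>a\<close>.\<close>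
    define i where "i = n ^ k"
    define s where "s = 1 + i * (m - 1)"
    define d where "d = i * (m - 1)"
    have d: "d \<ge> 1" using m n(1) by (simp add: d_def i_def)
    have "i + d = m * i" using m by (cases m) (auto simp: d_def)
    then have id: "a [^] (i + d) = a [^] i" using per by (simp add: i_def)
    have shift: "a [^] (t + d) = a [^] t" if "t \<ge> i" for t
    proof -
      obtain l where "t = i + l" using \<open>t \<ge> i\<close> le_Suc_ex by blast
      then have "t + d = (i + d) + l" by simp
      then have "a [^] (t + d) = a [^] (i + d) \<otimes> a [^] l" using a by (simp only: nat_pow_mult)
      also have "\<dots> = a [^] t" using a id \<open>t = i + l\<close> by (simp only: nat_pow_mult)
      finally show ?thesis .
    qed
    have "i \<le> s" using m mult_le_mono2[of 1 "m - 1" i] unfolding s_def by linarith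
    have shifts: "a [^] (s + l * d) = a [^] s" for l
    proof (induction l)
      case (Suc l)
      then show ?case using shift[of "s + l * d"] \<open>i \<le> s\<close> by (simp add: ac_simps)
    qed simp
    \<comment> \<open>Raising to the power \<open>d + 1\<close> adds \<open>s\<close> periods to the
      exponent \<open>s\<close>; \<open>d \<ge> 1\<close> makes \<open>d + 1\<close> an admissible
      exponent for potency.\<close>
    have "(a [^] s) [^] (d + 1) = a [^] (s + s * d)"
      using a nat_pow_pow[of a s "d + 1"] by (simp only: distrib_left mult_1_right add.commute)
    then have "a [^] s = (a [^] s) [^] (d + 1)" using shifts by simp
    then have "potent R (a [^] s)" unfolding potent_def
      using a d by (intro conjI exI[of _ "d + 1"]) auto
    moreover have "a \<ominus> a [^] s \<in> prime_radical R" using pm[of i] by (simp add: s_def)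
    moreover have "a \<otimes> a [^] s = a [^] s \<otimes> a" using a by (metis nat_pow_Suc nat_pow_Suc2)
    ultimately show "\<exists>p. potent R p \<and> a \<ominus> p \<in> prime_radical R \<and> a \<otimes> p = p \<otimes> a" by blast
  qed
qed

theorem theorem3p3:
  fixes R :: "('a, 'b) ring_scheme"
  assumes "ring R"
  shows "strongly_periodic R \<longleftrightarrow> two_primal R \<and> weakly_periodic R"
  using ring.strongly_periodic_imp_two_primal_weakly_periodic[OF assms]
    ring.two_primal_weakly_periodic_imp_strongly_periodic[OF assms] by blast

end
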